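(* Let $\rho_{AB}=\sum_i p_i\,\varphi_{A,i}\otimes\sigma_{AB,i}$ be a bipartite state (finite sum), where $(p_i)$ is a probability distribution, the $\varphi_{A,i}$ are mutually orthogonal states of a subsystem held by $A$, and each $\sigma_{AB,i}$ is a bipartite state of a further subsystem held by $A$ and the system held by $B$. Then the negativity of $\rho_{AB}$ across the bipartition $A:B$ is $$\mathcal N[\rho_{AB}]=\sum_i p_i\,\mathcal N[\sigma_{AB,i}].$$
   Context: All Hilbert spaces are finite-dimensional. Party $A$ holds $\mathcal H_{A}=\mathcal H_{A'}\otimes\mathcal H_{A''}$ and party $B$ holds $\mathcal H_B$. The $\varphi_{A,i}$ are density operators (positive semidefinite, trace one) on $\mathcal H_{A'}$, and the $\sigma_{AB,i}$ are density operators on $\mathcal H_{A''}\otimes\mathcal H_B$. The states $\varphi_{A,i}$ are called orthogonal if they have mutually orthogonal supports, i.e. $\varphi_{A,i}\varphi_{A,j}=0$ for $i\neq j$. For a bipartite density operator $\tau$ shared between $A$ and $B$, the negativity is $\mathcal N[\tau]=\frac12\left(\|\tau^{T_B}\|_1-1\right)$, where $T_B$ denotes the partial transpose on $B$'s system (with respect to a fixed orthonormal basis) and $\|M\|_1=\mathrm{Tr}\sqrt{M^\dagger M}$. For $\sigma_{AB,i}$ the bipartition is $A'':B$, and for $\rho_{AB}$ it is $A'A'':B$. *)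

theory Defs
  imports "HOL-Analysis.Analysis"
begin

text \<open>
  Operators on a finite-dimensional Hilbert space with a fixed orthonormal basis indexed by
  a finite type \<open>'n\<close> are matrices of type \<open>complex^'n^'n\<close>; the tensor product of the spaces with
  basis types \<open>'m\<close> and \<open>'n\<close> has basis type \<open>'m \<times> 'n\<close>.
\<close>

type_synonym 'n cop = "complex ^ 'n ^ 'n"

definition conj_transpose :: "complex ^ 'n ^ 'm \<Rightarrow> complex ^ 'm ^ 'n" where
  "conj_transpose M = (\<chi> i j. cnj (M $ j $ i))"

definition pos_semidef :: "'n::finite cop \<Rightarrow> bool" where
  "pos_semidef M \<longleftrightarrow>
     conj_transpose M = M \<and> (\<forall>x. 0 \<le> Re (\<Sum>i\<in>UNIV. cnj (x $ i) * (M *v x) $ i))"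

definition density_operator :: "'n::finite cop \<Rightarrow> bool" where
  "density_operator M \<longleftrightarrow> pos_semidef M \<and> trace M = 1"

definition orthogonal_states :: "'n::finite cop \<Rightarrow> 'n cop \<Rightarrow> bool" where
  "orthogonal_states M N \<longleftrightarrow> M ** N = 0"

text \<open>
  The description is proper only for positive semidefinite \<open>M\<close>, which have exactly one positive
  semidefinite square root; it is only applied to matrices of the form \<open>M\<^sup>\<dagger>M\<close>.
\<close>
definition psd_sqrt :: "'n::finite cop \<Rightarrow> 'n cop" where
  "psd_sqrt M = (THE R. pos_semidef R \<and> R ** R = M)"

text \<open>The trace of a positive semidefinite matrix is real, so \<open>Re\<close> is merely a coercion.\<close>
definition trace_norm :: "'n::finite cop \<Rightarrow> real" where
  "trace_norm M = Re (trace (psd_sqrt (conj_transpose M ** M)))"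

definition tensor_op :: "'m::finite cop \<Rightarrow> 'n::finite cop \<Rightarrow> ('m \<times> 'n) cop" where
  "tensor_op M N = (\<chi> r s. M $ fst r $ fst s * N $ snd r $ snd s)"

text \<open>
  The canonical identification of operators on \<open>H\<^sub>1 \<otimes> (H\<^sub>2 \<otimes> H\<^sub>3)\<close> with operators on
  \<open>(H\<^sub>1 \<otimes> H\<^sub>2) \<otimes> H\<^sub>3\<close>.
\<close>
definition regroup ::
  "('a::finite \<times> ('c::finite \<times> 'b::finite)) cop \<Rightarrow> (('a \<times> 'c) \<times> 'b) cop" where
  "regroup M = (\<chi> r s. M $ (fst (fst r), (snd (fst r), snd r)) $ (fst (fst s), (snd (fst s), snd s)))"

text \<open>Transposition on the second tensor factor: \<open>\<langle>a b|M\<^sup>T\<^sup>B|a' b'\<rangle> = \<langle>a b'|M|a' b\<rangle>\<close>.\<close>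
definition partial_transpose :: "('a::finite \<times> 'b::finite) cop \<Rightarrow> ('a \<times> 'b) cop" where
  "partial_transpose M = (\<chi> r s. M $ (fst r, snd s) $ (fst s, snd r))"

text \<open>The bipartition is given by the two factors of the index type.\<close>
definition negativity :: "('a::finite \<times> 'b::finite) cop \<Rightarrow> real" where
  "negativity M = (trace_norm (partial_transpose M) - 1) / 2"

end

(* With tau_i the partial transpose of sigma_i and |M| = sqrt (M^* M), the partial transpose of rho is
   T = sum_i p_i phi_i (x) tau_i. Orthogonality kills the cross terms in T^* T, so the positive
   semidefinite matrix sum_i p_i phi_i (x) |tau_i| squares to T^* T; by uniqueness of the square root
   it is |T|, and its trace is sum_i p_i tr |tau_i|. *)

theory Submission
  imports Defs
begin

section \<open>The complex inner product\<close>

definition cdot :: "complex ^ 'n::finite \<Rightarrow> complex ^ 'n \<Rightarrow> complex" where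
  "cdot x y = (\<Sum>i\<in>UNIV. cnj (x $ i) * y $ i)"

lemma cdot_add_left: "cdot (x + y) z = cdot x z + cdot y z"
  by (simp add: cdot_def algebra_simps sum.distrib)

lemma cdot_add_right: "cdot z (x + y) = cdot z x + cdot z y"
  by (simp add: cdot_def algebra_simps sum.distrib)

lemma cdot_diff_left: "cdot (x - y) z = cdot x z - cdot y z"
  by (simp add: cdot_def algebra_simps sum_subtractf)

lemma cdot_diff_right: "cdot z (x - y) = cdot z x - cdot z y"
  by (simp add: cdot_def algebra_simps sum_subtractf)

lemma cdot_smult_left: "cdot (c *s x) y = cnj c * cdot x y"
  by (simp add: cdot_def algebra_simps sum_distrib_left)

lemma cdot_smult_right: "cdot x (c *s y) = c * cdot x y"
  by (simp add: cdot_def algebra_simps sum_distrib_left)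

lemma cdot_scaleR_right: "cdot x (r *\<^sub>R y) = of_real r * cdot x y"
  by (simp add: cdot_def vector_scaleR_component scaleR_conv_of_real[of r "_ :: complex"]
      sum_distrib_left mult_ac)

lemma cdot_zero_right [simp]: "cdot x 0 = 0"
  by (simp add: cdot_def)

lemma cnj_cdot: "cnj (cdot x y) = cdot y x"
  by (simp add: cdot_def mult.commute)

lemma cdot_axis_left: "cdot (axis i 1) y = y $ i"
proof -
  have "cdot (axis i 1) y = (\<Sum>k\<in>UNIV. if k = i then y $ k else 0)"
    unfolding cdot_def by (intro sum.cong) (auto simp: axis_def)
  then show ?thesis by simp
qed

lemma cdot_self: "cdot x x = of_real (\<Sum>i\<in>UNIV. (cmod (x $ i))\<^sup>2)"
  by (simp add: cdot_def complex_norm_square mult.commute del: of_real_power)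

lemma cdot_self_eq_0_iff: "cdot x x = 0 \<longleftrightarrow> x = 0"
  unfolding cdot_self of_real_eq_0_iff
  by (subst sum_nonneg_eq_0_iff) (auto simp: vec_eq_iff)

lemma cdot_self_nonneg: "0 \<le> Re (cdot x x)"
  by (simp add: cdot_self sum_nonneg)

lemma cdot_mult_vec_left: "cdot (M *v x) y = cdot x (conj_transpose M *v y)"
proof -
  have "cdot (M *v x) y = (\<Sum>i\<in>UNIV. \<Sum>j\<in>UNIV. cnj (M $ i $ j) * cnj (x $ j) * y $ i)"
    by (simp add: cdot_def matrix_vector_mult_def sum_distrib_right)
  also have "\<dots> = (\<Sum>j\<in>UNIV. \<Sum>i\<in>UNIV. cnj (M $ i $ j) * cnj (x $ j) * y $ i)"
    by (rule sum.swap)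
  also have "\<dots> = cdot x (conj_transpose M *v y)"
    by (simp add: cdot_def matrix_vector_mult_def conj_transpose_def sum_distrib_left algebra_simps)
  finally show ?thesis .
qed

section \<open>Adjoints and sums of matrices\<close>

lemma conj_transpose_nth [simp]: "conj_transpose M $ i $ j = cnj (M $ j $ i)"
  by (simp add: conj_transpose_def)

lemma conj_transpose_conj_transpose [simp]: "conj_transpose (conj_transpose M) = M"
  by (simp add: vec_eq_iff)

lemma conj_transpose_mult: "conj_transpose (A ** B) = conj_transpose B ** conj_transpose A"
  by (simp add: vec_eq_iff matrix_matrix_mult_def mult.commute)

lemma conj_transpose_mat_1: "conj_transpose (mat 1) = mat 1"
  by (simp add: vec_eq_iff mat_def)

lemma conj_transpose_add: "conj_transpose (A + B) = conj_transpose A + conj_transpose B"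
  by (simp add: vec_eq_iff)

lemma conj_transpose_diff: "conj_transpose (A - B) = conj_transpose A - conj_transpose B"
  by (simp add: vec_eq_iff)

lemma conj_transpose_scaleR: "conj_transpose (r *\<^sub>R A) = r *\<^sub>R conj_transpose A"
  by (simp add: vec_eq_iff)

lemma conj_transpose_sum: "conj_transpose (\<Sum>i\<in>I. A i) = (\<Sum>i\<in>I. conj_transpose (A i))"
  by (simp add: vec_eq_iff)

lemma matrix_mult_add_left: "(A + B) ** C = A ** C + B ** C" for A :: "complex^'n::finite^'m"
  by (simp add: vec_eq_iff matrix_matrix_mult_def distrib_right sum.distrib)

lemma matrix_mult_diff_left: "(A - B) ** C = A ** C - B ** C" for A :: "complex^'n::finite^'m"
  by (simp add: vec_eq_iff matrix_matrix_mult_def left_diff_distrib sum_subtractf)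

lemma matrix_mult_diff_right: "C ** (A - B) = C ** A - C ** B" for A :: "complex^'n^'m::finite"
  by (simp add: vec_eq_iff matrix_matrix_mult_def right_diff_distrib sum_subtractf)

lemma matrix_mult_sum_left: "(\<Sum>i\<in>I. A i) ** B = (\<Sum>i\<in>I. A i ** B)"
  for A :: "'i \<Rightarrow> complex^'n::finite^'m"
  by (induction I rule: infinite_finite_induct) (auto simp: matrix_mult_add_left)

lemma matrix_mult_sum_right: "B ** (\<Sum>i\<in>I. A i) = (\<Sum>i\<in>I. B ** A i)"
  for A :: "'i \<Rightarrow> complex^'n^'m::finite"
  by (induction I rule: infinite_finite_induct) (auto simp: matrix_add_ldistrib)

lemma matrix_mult_scaleR: "(r *\<^sub>R A) ** (s *\<^sub>R B) = (r * s) *\<^sub>R (A ** B)"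
  for A :: "complex^'n::finite^'m"
  unfolding vec_eq_iff matrix_matrix_mult_def
  by (simp add: scaleR_sum_right mult_ac)

lemma trace_diff: "trace (A - B) = trace A - trace B" for A :: "complex^'n^'n"
  by (simp add: trace_def sum_subtractf)

lemma trace_sum_scaleR: "trace (\<Sum>i\<in>I. r i *\<^sub>R A i) = (\<Sum>i\<in>I. r i *\<^sub>R trace (A i))"
  for A :: "'i \<Rightarrow> complex^'n^'n"
  unfolding trace_def sum_component vector_scaleR_component scaleR_sum_right by (rule sum.swap)

text \<open>Complex polarization: expanding the form at \<open>x + y\<close> makes the two cross
  terms cancel each other. Replacing \<open>y\<close> by \<open>\<i> *s y\<close> makes them equal
  instead, so each is zero.\<close>

lemma quadratic_form_zero:
  fixes Q :: "'n::finite cop"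
  assumes "\<And>x. cdot x (Q *v x) = 0"
  shows "Q = 0"
proof -
  have 1: "cdot x (Q *v y) + cdot y (Q *v x) = 0" for x y
    using assms[of "x + y"] assms
    by (simp add: matrix_vector_right_distrib cdot_add_left cdot_add_right add.commute)
  have 2: "cdot x (Q *v y) = 0" for x y
    using 1[of x y] 1[of x "\<i> *s y"]
    by (simp add: vector_scalar_commute cdot_smult_left cdot_smult_right)
  have "Q *v y = 0" for y
    using 2[of "Q *v y" y] by (simp add: cdot_self_eq_0_iff)
  then show ?thesis
    by (simp add: matrix_eq)
qed

section \<open>Positive semidefinite matrices\<close>

lemma pos_semidef_iff:
  "pos_semidef M \<longleftrightarrow> conj_transpose M = M \<and> (\<forall>x. 0 \<le> Re (cdot x (M *v x)))"
  by (simp add: pos_semidef_def cdot_def)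

lemma cdot_hermitian_Im:
  assumes "conj_transpose M = M"
  shows "Im (cdot x (M *v x)) = 0"
proof -
  have "cnj (cdot x (M *v x)) = cdot x (M *v x)"
    by (simp add: cnj_cdot cdot_mult_vec_left assms)
  from arg_cong[OF this, of Im] show ?thesis
    by simp
qed

text \<open>The forms of \<open>P\<close> and its adjoint are complex conjugates, so they agree when
  the values are real, and polarization makes \<open>P\<close> Hermitian. The extremal argument for
  the polar decomposition yields information on the form alone.\<close>

lemma pos_semidef_if_form_nonneg:
  fixes P :: "'n::finite cop"
  assumes "\<And>x. Im (cdot x (P *v x)) = 0" "\<And>x. 0 \<le> Re (cdot x (P *v x))"
  shows "pos_semidef P"
proof -
  have "cdot x ((conj_transpose P - P) *v x) = 0" for x
  proof -
    have "cdot x (conj_transpose P *v x) = cnj (cdot x (P *v x))"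
      by (simp add: cdot_mult_vec_left[symmetric] cnj_cdot)
    also have "\<dots> = cdot x (P *v x)"
      by (simp add: complex_eq_iff assms)
    finally show ?thesis
      by (simp add: matrix_vector_mult_diff_rdistrib cdot_diff_right)
  qed
  then have "conj_transpose P - P = 0"
    by (rule quadratic_form_zero)
  then show ?thesis
    using assms by (simp add: pos_semidef_iff)
qed

lemma pos_semidef_zero: "pos_semidef 0"
  by (simp add: pos_semidef_iff vec_eq_iff)

lemma pos_semidef_add: "pos_semidef A \<Longrightarrow> pos_semidef B \<Longrightarrow> pos_semidef (A + B)"
  by (simp add: pos_semidef_iff conj_transpose_add matrix_vector_mult_add_rdistrib cdot_add_right)

lemma scaleR_mult_vec: "(r *\<^sub>R A) *v x = r *\<^sub>R (A *v x)" for A :: "complex^'n::finite^'m"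
  by (simp add: vec_eq_iff matrix_vector_mult_def scaleR_sum_right)

lemma pos_semidef_scaleR: "0 \<le> r \<Longrightarrow> pos_semidef A \<Longrightarrow> pos_semidef (r *\<^sub>R A)"
  by (simp add: pos_semidef_iff conj_transpose_scaleR scaleR_mult_vec
      cdot_scaleR_right)

lemma pos_semidef_sum: "(\<And>i. i \<in> I \<Longrightarrow> pos_semidef (A i)) \<Longrightarrow> pos_semidef (\<Sum>i\<in>I. A i)"
  by (induction I rule: infinite_finite_induct) (auto simp: pos_semidef_zero pos_semidef_add)

lemma pos_semidef_conj_mult:
  assumes "pos_semidef A"
  shows "pos_semidef (conj_transpose B ** A ** B)"
  using assms
  by (simp add: pos_semidef_iff conj_transpose_mult matrix_mul_assoc
      matrix_vector_mul_assoc[symmetric] cdot_mult_vec_left[symmetric])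

lemma mult_vec_axis: "A *v axis k 1 = column k A" for A :: "complex^'n::finite^'m"
proof -
  have "(A *v axis k 1) $ i = (\<Sum>j\<in>UNIV. if j = k then A $ i $ j else 0)" for i
    unfolding matrix_vector_mult_def vec_lambda_beta by (intro sum.cong) (auto simp: axis_def)
  then show ?thesis by (simp add: vec_eq_iff column_def)
qed

lemma cdot_axis_mult_vec: "cdot (axis i 1) (A *v axis i 1) = A $ i $ i"
  by (simp add: cdot_axis_left mult_vec_axis column_def)

lemma pos_semidef_diag_nonneg: "pos_semidef A \<Longrightarrow> 0 \<le> Re (A $ i $ i)"
  by (metis cdot_axis_mult_vec pos_semidef_iff)

lemma pos_semidef_diag_Im: "pos_semidef A \<Longrightarrow> Im (A $ i $ i) = 0"
  by (metis cdot_axis_mult_vec cdot_hermitian_Im pos_semidef_iff)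

text \<open>Along the line \<open>y + t x\<close> with \<open>y = A *v x\<close> the quadratic term
  in \<open>t\<close> vanishes, so the form is affine in \<open>t\<close> with slope twice the
  squared norm of \<open>y\<close>. Being bounded below, it must have slope zero.\<close>

lemma pos_semidef_kernel:
  assumes A: "pos_semidef A" and 0: "Re (cdot x (A *v x)) = 0"
  shows "A *v x = 0"
proof -
  define y where "y = A *v x"
  define s where "s = Re (cdot y (A *v y))"
  define N where "N = Re (cdot y y)"
  have herm: "conj_transpose A = A"
    using A by (simp add: pos_semidef_iff)
  have ge: "0 \<le> s + 2 * t * N" for t :: real
  proof -
    have "cdot x (A *v y) = cdot y y"
      by (simp add: y_def cdot_mult_vec_left herm)
    then have "Re (cdot (y + of_real t *s x) (A *v (y + of_real t *s x))) = s + 2 * t * N"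
      using 0 by (simp add: y_def[symmetric] s_def N_def matrix_vector_right_distrib
          vector_scalar_commute cdot_add_left cdot_add_right cdot_smult_left cdot_smult_right
          algebra_simps)
    then show ?thesis
      using A by (metis pos_semidef_iff)
  qed
  have "0 \<le> N"
    by (simp add: N_def cdot_self_nonneg)
  moreover have "\<not> 0 < N"
  proof
    assume "0 < N"
    then show False
      \<comment> \<open>This \<open>t\<close> makes the affine function equal to -1.\<close>
      using ge[of "- (s + 1) / (2 * N)"] by (simp add: field_simps)
  qed
  ultimately have "cdot y y = 0"
    by (simp add: N_def cdot_self)
  then show ?thesis
    by (simp add: cdot_self_eq_0_iff y_def)
qed

text \<open>The diagonal entries of \<open>B^* A B\<close> are the values of the form of
  \<open>A\<close> at the columns of \<open>B\<close>. They are nonnegative with sum zero, so each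
  vanishes and \<open>A\<close> annihilates every column.\<close>

lemma pos_semidef_trace_zero:
  assumes A: "pos_semidef A" and "Re (trace (conj_transpose B ** A ** B)) = 0"
  shows "A ** B = 0"
proof -
  let ?C = "conj_transpose B ** A ** B"
  have "Re (?C $ i $ i) = 0" for i
  proof -
    have "(\<Sum>i\<in>UNIV. Re (?C $ i $ i)) = 0"
      using assms(2) by (simp add: trace_def)
    then show ?thesis
      using pos_semidef_diag_nonneg[OF pos_semidef_conj_mult[OF A, of B]]
      by (subst (asm) sum_nonneg_eq_0_iff) auto
  qed
  then have "Re (cdot (axis i 1) (?C *v axis i 1)) = 0" for i
    by (simp add: cdot_axis_mult_vec)
  then have "Re (cdot (B *v axis i 1) (A *v (B *v axis i 1))) = 0" for i
    by (simp add: cdot_mult_vec_left matrix_vector_mul_assoc matrix_mul_assoc)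
  then have "(A ** B) *v axis i 1 = 0" for i
    using pos_semidef_kernel[OF A] by (simp add: matrix_vector_mul_assoc[symmetric])
  then have "column i (A ** B) = 0" for i
    by (simp add: mult_vec_axis)
  then show ?thesis
    by (simp add: vec_eq_iff column_def)
qed

section \<open>Square roots\<close>

text \<open>With \<open>D = R - S\<close> one has \<open>R\<^sup>2 - S\<^sup>2 = R D + D S\<close>, so that \<open>tr (D R D) + tr (D S D) = 0\<close>;
  both summands are nonnegative.\<close>

lemma pos_semidef_sqrt_unique:
  fixes R S :: "'n::finite cop"
  assumes R: "pos_semidef R" and S: "pos_semidef S" and eq: "R ** R = S ** S"
  shows "R = S"
proof -
  define D where "D = R - S"
  have D: "conj_transpose D = D"
    using R S by (simp add: D_def conj_transpose_diff pos_semidef_iff)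
  have "R ** D + D ** S = 0"
    by (simp add: D_def matrix_mult_diff_left matrix_mult_diff_right eq)
  then have "trace (D ** (R ** D + D ** S)) = 0"
    by (simp add: trace_def)
  then have "trace (D ** R ** D) + trace (D ** (D ** S)) = 0"
    by (simp add: matrix_add_ldistrib trace_add matrix_mul_assoc)
  moreover have "trace (D ** (D ** S)) = trace (D ** S ** D)"
    by (metis trace_mul_sym matrix_mul_assoc)
  ultimately have "Re (trace (D ** R ** D)) + Re (trace (D ** S ** D)) = 0"
    by (metis plus_complex.simps(1) zero_complex.simps(1))
  moreover have "0 \<le> Re (trace (D ** R ** D))" "0 \<le> Re (trace (D ** S ** D))"
    using pos_semidef_diag_nonneg[OF pos_semidef_conj_mult[OF R, of D]]
      pos_semidef_diag_nonneg[OF pos_semidef_conj_mult[OF S, of D]]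
    by (auto simp: trace_def D intro!: sum_nonneg)
  ultimately have "Re (trace (D ** R ** D)) = 0" "Re (trace (D ** S ** D)) = 0"
    by auto
  then have "R ** D = 0" "S ** D = 0"
    using pos_semidef_trace_zero[OF R, of D] pos_semidef_trace_zero[OF S, of D] D by auto
  \<comment> \<open>\<open>D ** D\<close> is \<open>R ** D - S ** D\<close>. As \<open>D\<close> is
    Hermitian, the squared norm of \<open>D *v x\<close> is the form of \<open>D ** D\<close> at
    \<open>x\<close>.\<close>
  then have "D ** D = 0"
    by (simp add: D_def matrix_mult_diff_left matrix_mult_diff_right)
  then have "cdot (D *v x) (D *v x) = 0" for x
    by (simp add: cdot_mult_vec_left D matrix_vector_mul_assoc)
  then have "D *v x = 0" for x
    by (simp add: cdot_self_eq_0_iff)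
  then have "D = 0"
    by (simp add: matrix_eq)
  then show ?thesis by (simp add: D_def)
qed

section \<open>Rank-one matrices, unitaries and the polar decomposition\<close>

definition outer :: "complex ^ 'n \<Rightarrow> complex ^ 'm \<Rightarrow> complex ^ 'm ^ 'n" where
  "outer u v = (\<chi> i j. u $ i * cnj (v $ j))"

lemma outer_mult_vec: "outer u v *v x = cdot v x *s u"
  by (simp add: vec_eq_iff outer_def matrix_vector_mult_def cdot_def sum_distrib_left
      sum_distrib_right algebra_simps)

lemma conj_transpose_outer: "conj_transpose (outer u v) = outer v u"
  by (simp add: vec_eq_iff outer_def mult.commute)

lemma trace_outer_mult: "trace (outer u v ** P) = cdot v (P *v u)"
proof -
  have "trace (outer u v ** P) = (\<Sum>i\<in>UNIV. \<Sum>k\<in>UNIV. u $ i * cnj (v $ k) * P $ k $ i)"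
    by (simp add: trace_def outer_def matrix_matrix_mult_def)
  also have "\<dots> = (\<Sum>k\<in>UNIV. \<Sum>i\<in>UNIV. u $ i * cnj (v $ k) * P $ k $ i)"
    by (rule sum.swap)
  also have "\<dots> = cdot v (P *v u)"
    by (simp add: cdot_def matrix_vector_mult_def sum_distrib_left algebra_simps)
  finally show ?thesis .
qed

definition unitaries :: "'n::finite cop set" where
  "unitaries = {U. conj_transpose U ** U = mat 1}"

text \<open>The diagonal of \<open>U^* U\<close> holds the squared norms of the columns, all equal
  to 1.\<close>

lemma unitary_entry_le:
  assumes "U \<in> unitaries"
  shows "cmod (U $ i $ j) \<le> 1"
proof -
  have "(conj_transpose U ** U) $ j $ j = 1"
    using assms by (simp add: unitaries_def mat_def)
  then have "of_real (\<Sum>k\<in>UNIV. (cmod (U $ k $ j))\<^sup>2) = (1 :: complex)"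
    by (simp add: matrix_matrix_mult_def complex_norm_square mult.commute del: of_real_power)
  then have "(\<Sum>k\<in>UNIV. (cmod (U $ k $ j))\<^sup>2) = 1"
    using of_real_eq_1_iff by blast
  then have "(cmod (U $ i $ j))\<^sup>2 \<le> 1"
    using member_le_sum[of i UNIV "\<lambda>k. (cmod (U $ k $ j))\<^sup>2"] by simp
  then show ?thesis
    by (simp add: power_le_one_iff abs_square_le_1)
qed

text \<open>Heine-Borel: the entries are bounded, and unitarity is a system of continuous equations
  in them. Compactness provides the maximiser in the polar decomposition.\<close>

lemma compact_unitaries: "compact (unitaries :: 'n::finite cop set)"
proof -
  have "bounded (unitaries :: 'n cop set)"
  proof (rule boundedI)
    fix U :: "'n cop" assume U: "U \<in> unitaries"
    have "norm U \<le> (\<Sum>i\<in>UNIV. norm (U $ i))"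
      unfolding norm_vec_def by (rule L2_set_le_sum) simp
    also have "\<dots> \<le> (\<Sum>i\<in>UNIV. \<Sum>j\<in>UNIV. cmod (U $ i $ j))"
      unfolding norm_vec_def[of "U $ _"] by (intro sum_mono L2_set_le_sum) simp
    also have "\<dots> \<le> (\<Sum>i\<in>(UNIV::'n set). \<Sum>j\<in>(UNIV::'n set). 1)"
      by (intro sum_mono unitary_entry_le U)
    finally show "norm U \<le> (\<Sum>i\<in>(UNIV::'n set). \<Sum>j\<in>(UNIV::'n set). 1)" .
  qed
  moreover have "closed (unitaries :: 'n cop set)"
    unfolding unitaries_def vec_eq_iff conj_transpose_def matrix_matrix_mult_def
    by (auto intro!: closed_Collect_all closed_Collect_eq continuous_intros)
  ultimately show ?thesis
    by (simp add: compact_eq_bounded_closed)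
qed

text \<open>This matrix multiplies \<open>v\<close> by \<open>e\<close> and fixes the orthogonal
  complement of \<open>v\<close>. The computation comes down to
  \<open>cnj e * e = 1\<close>.\<close>

lemma reflection_unitary:
  fixes v :: "complex ^ 'n::finite"
  assumes v: "cdot v v = 1" and e: "cmod e = 1"
  shows "mat 1 - outer ((1 - e) *s v) v \<in> unitaries"
proof -
  let ?V = "mat 1 - outer ((1 - e) *s v) v"
  have ee: "cnj e * e = 1"
    using e by (metis complex_norm_square mult.commute of_real_1 power_one)
  have "(conj_transpose ?V ** ?V) *v x = mat 1 *v x" for x
  proof -
    have "conj_transpose ?V = mat 1 - outer v ((1 - e) *s v)"
      by (simp add: conj_transpose_diff conj_transpose_outer conj_transpose_mat_1)
    then show ?thesis
      using ee
      by (simp add: matrix_vector_mul_assoc[symmetric] matrix_vector_mult_diff_rdistrib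
          outer_mult_vec cdot_diff_right cdot_smult_left cdot_smult_right v
          del: vector_sub_rdistrib)
         (simp add: vec_eq_iff algebra_simps)
  qed
  then show ?thesis
    unfolding unitaries_def mem_Collect_eq by (subst matrix_eq) blast
qed

text \<open>Polar decomposition: if \<open>U\<close> maximises \<open>Re (tr (U M))\<close> over the unitaries, then \<open>U M\<close> is the
  positive part. Indeed comparing \<open>U\<close> with \<open>V U\<close>, where \<open>V\<close> multiplies the unit vector \<open>v\<close> by the phase
  \<open>e\<close>, yields \<open>Re ((1 - e) z) \<ge> 0\<close> for \<open>z = \<langle>v, U M v\<rangle>\<close>, and \<open>e = cnj z / \<bar>z\<bar>\<close> gives \<open>Re z \<ge> \<bar>z\<bar>\<close>.\<close>

lemma pos_semidef_sqrt_exists: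
  fixes M :: "'n::finite cop"
  shows "\<exists>R. pos_semidef R \<and> R ** R = conj_transpose M ** M"
proof -
  have "continuous_on unitaries (\<lambda>U :: 'n cop. Re (trace (U ** M)))"
    unfolding trace_def matrix_matrix_mult_def by (simp) (intro continuous_intros)
  moreover have "mat 1 \<in> (unitaries :: 'n cop set)"
    by (simp add: unitaries_def conj_transpose_mat_1)
  ultimately obtain U :: "'n cop" where U: "U \<in> unitaries"
    and max: "\<And>W. W \<in> unitaries \<Longrightarrow> Re (trace (W ** M)) \<le> Re (trace (U ** M))"
    using continuous_attains_sup[OF compact_unitaries] by blast
  define P where "P = U ** M"
  have unit: "cmod (cdot v (P *v v)) \<le> Re (cdot v (P *v v))" if v: "cdot v v = 1" for v
  proof -
    define z where "z = cdot v (P *v v)"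
    \<comment> \<open>The phase that rotates \<open>z\<close> onto its modulus. At
      \<open>z = 0\<close> the quotient would be 0, which is no phase, so 1 stands in.\<close>
    define e where "e = (if z = 0 then 1 else cnj z / of_real (cmod z))"
    have e: "cmod e = 1"
      by (simp add: e_def norm_divide)
    let ?V = "mat 1 - outer ((1 - e) *s v) v"
    have "?V ** U \<in> unitaries"
      using reflection_unitary[OF v e] U unfolding unitaries_def
      by (simp add: conj_transpose_mult) (metis matrix_mul_assoc matrix_mul_lid)
    from max[OF this] have "Re (trace (?V ** P)) \<le> Re (trace P)"
      by (simp add: P_def matrix_mul_assoc)
    then have "0 \<le> Re ((1 - e) * z)"
      by (simp add: matrix_mult_diff_left trace_diff trace_outer_mult vector_scalar_commute
          cdot_smult_right z_def del: vector_sub_rdistrib)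
    moreover have "e * z = of_real (cmod z)"
      by (simp add: e_def mult.commute[of "cnj z"] complex_norm_square[symmetric] power2_eq_square)
    ultimately show ?thesis
      by (simp add: z_def[symmetric] left_diff_distrib)
  qed
  \<comment> \<open>The form scales by the squared norm \<open>n\<^sup>2\<close>, so the bound
    passes from unit vectors to all vectors.\<close>
  have gen: "cmod (cdot x (P *v x)) \<le> Re (cdot x (P *v x))" for x
  proof (cases "x = 0")
    case False
    define n where "n = sqrt (\<Sum>i\<in>UNIV. (cmod (x $ i))\<^sup>2)"
    have nn: "cdot x x = of_real (n * n)"
      by (simp add: n_def cdot_self sum_nonneg del: of_real_mult)
    have n0: "n \<noteq> 0"
      using False cdot_self_eq_0_iff[of x] nn by auto
    define v where "v = of_real (1 / n) *s x"
    have "cdot v v = 1"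
      using n0 by (simp add: v_def cdot_smult_left cdot_smult_right nn)
    moreover have "cdot x (P *v x) = of_real (n\<^sup>2) * cdot v (P *v v)"
      using n0
      by (simp add: v_def vector_scalar_commute cdot_smult_left cdot_smult_right power2_eq_square)
    ultimately show ?thesis
      using mult_left_mono[OF unit[of v], of "n\<^sup>2"] by (simp add: norm_mult del: of_real_power)
  qed simp
  have "Im (cdot x (P *v x)) = 0" "0 \<le> Re (cdot x (P *v x))" for x
  proof -
    show "0 \<le> Re (cdot x (P *v x))"
      using gen[of x] norm_ge_zero order_trans by blast
    \<comment> \<open>Squaring the bound leaves no room for an imaginary part.\<close>
    show "Im (cdot x (P *v x)) = 0"
      using power_mono[OF gen[of x] norm_ge_zero, of 2] by (simp add: cmod_power2)
  qed
  then have P: "pos_semidef P"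
    by (rule pos_semidef_if_form_nonneg)
  moreover have "P ** P = conj_transpose M ** M"
  proof -
    \<comment> \<open>Once \<open>P\<close> is Hermitian its square is a Gram matrix, in which
      \<open>U^* U\<close> cancels.\<close>
    have "P ** P = conj_transpose P ** P"
      using P by (simp add: pos_semidef_iff)
    also have "\<dots> = conj_transpose M ** (conj_transpose U ** U) ** M"
      by (simp add: P_def conj_transpose_mult matrix_mul_assoc)
    finally show ?thesis
      using U by (simp add: unitaries_def)
  qed
  ultimately show ?thesis by blast
qed

lemma psd_sqrt_eqI: "pos_semidef R \<Longrightarrow> R ** R = M \<Longrightarrow> psd_sqrt M = R"
  unfolding psd_sqrt_def by (blast intro: the_equality pos_semidef_sqrt_unique)

text \<open>Existence supplies a root and uniqueness identifies it with the definite
  description.\<close>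

lemma psd_sqrt_gram:
  fixes M :: "'n::finite cop"
  defines "R \<equiv> psd_sqrt (conj_transpose M ** M)"
  shows "pos_semidef R" "R ** R = conj_transpose M ** M"
  using pos_semidef_sqrt_exists[of M] psd_sqrt_eqI unfolding R_def by blast+

section \<open>Tensor products\<close>

lemma pos_semidef_outer: "pos_semidef (outer v v)"
proof -
  have "cdot x (outer v v *v x) = of_real ((cmod (cdot v x))\<^sup>2)" for x
    by (simp add: outer_mult_vec cdot_smult_right complex_norm_square cnj_cdot del: of_real_power)
  then show ?thesis
    by (simp add: pos_semidef_iff conj_transpose_outer del: of_real_power)
qed

text \<open>One step of the Cholesky decomposition.\<close>

lemma pos_semidef_schur_complement:
  fixes A :: "'n::finite cop"
  assumes A: "pos_semidef A" and a: "A $ k $ k = of_real (r\<^sup>2)" "r \<noteq> 0"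
  defines "v \<equiv> of_real (1 / r) *s (A *v axis k 1)"
  shows "pos_semidef (A - outer v v)"
proof -
  have herm: "conj_transpose A = A"
    using A by (simp add: pos_semidef_iff)
  have "0 \<le> Re (cdot x ((A - outer v v) *v x))" for x
  proof -
    let ?e = "axis k 1 :: complex^'n"
    define w where "w = cdot ?e (A *v x)"
    have w': "cdot x (A *v ?e) = cnj w"
      by (simp add: w_def cnj_cdot cdot_mult_vec_left herm)
    have vx: "cdot v x = w / of_real r"
      by (simp add: v_def cdot_smult_left cdot_mult_vec_left herm w_def)
    have xv: "cdot x v = cnj w / of_real r"
      by (metis vx cnj_cdot complex_cnj_divide complex_cnj_complex_of_real)
    have "cdot x ((A - outer v v) *v x) = cdot x (A *v x) - w * cnj w / of_real (r\<^sup>2)"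
      by (simp add: matrix_vector_mult_diff_rdistrib cdot_diff_right outer_mult_vec
          cdot_smult_right vx xv power2_eq_square)
    \<comment> \<open>Completing the square: \<open>w / r\<^sup>2\<close> is the multiple of
      \<open>?e\<close> whose subtraction from \<open>x\<close> minimises the form of
      \<open>A\<close>.\<close>
    also have "\<dots> = cdot (x - (w / of_real (r\<^sup>2)) *s ?e) (A *v (x - (w / of_real (r\<^sup>2)) *s ?e))"
      using a(2) by (simp add: matrix_vector_mult_diff_distrib vector_scalar_commute cdot_diff_left
          cdot_diff_right cdot_smult_left cdot_smult_right w' w_def[symmetric]
          cdot_axis_mult_vec a(1))
    finally show ?thesis
      using A by (simp add: pos_semidef_iff)
  qed
  then show ?thesis
    by (simp add: pos_semidef_iff conj_transpose_diff conj_transpose_outer herm)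
qed

text \<open>Cholesky decomposition as an induction rule. Each step subtracts an outer product that
  clears one diagonal entry and revives none, so the number of nonzero diagonal entries
  drops.\<close>

lemma pos_semidef_induct [consumes 1, case_names zero add_outer]:
  fixes A :: "'n::finite cop"
  assumes "pos_semidef A"
    and zero: "Q 0"
    and add_outer: "\<And>B v. Q B \<Longrightarrow> Q (B + outer v v)"
  shows "Q A"
  using assms(1)
proof (induction "card {i. A $ i $ i \<noteq> 0}" arbitrary: A rule: less_induct)
  case less
  show ?case
  proof (cases "\<exists>k. A $ k $ k \<noteq> 0")
    case False
    \<comment> \<open>With zero diagonal the form vanishes at every basis vector, so the kernel
      lemma removes all columns.\<close>
    then have "A *v axis i 1 = 0" for i
      by (intro pos_semidef_kernel less.prems) (simp add: cdot_axis_mult_vec)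
    then have "column i A = 0" for i
      by (simp add: mult_vec_axis)
    then have "A = 0"
      by (simp add: vec_eq_iff column_def)
    then show ?thesis using zero by simp
  next
    case True
    then obtain k where k: "A $ k $ k \<noteq> 0" by blast
    define r where "r = sqrt (Re (A $ k $ k))"
    have r: "A $ k $ k = of_real (r\<^sup>2)"
      using pos_semidef_diag_nonneg[OF less.prems, of k] pos_semidef_diag_Im[OF less.prems, of k]
      by (simp add: r_def complex_eq_iff del: of_real_power)
    with k have r0: "r \<noteq> 0" by auto
    define v where "v = of_real (1 / r) *s (A *v axis k 1)"
    define B where "B = A - outer v v"
    have B: "pos_semidef B"
      unfolding B_def v_def by (rule pos_semidef_schur_complement[OF less.prems r r0])
    have Bi: "B $ i $ i = A $ i $ i - of_real ((cmod (v $ i))\<^sup>2)" for i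
      by (simp add: B_def outer_def complex_norm_square del: of_real_power)
    have "v $ k = of_real r"
      using r r0 cdot_axis_mult_vec[of k A]
      by (simp add: v_def cdot_axis_left power2_eq_square)
    then have Bk: "B $ k $ k = 0"
      by (simp add: Bi r)
    \<comment> \<open>Here the entry of \<open>B\<close> is minus a squared modulus, yet nonnegative
      because \<open>B\<close> is positive semidefinite.\<close>
    have Bz: "B $ i $ i = 0" if "A $ i $ i = 0" for i
      using pos_semidef_diag_nonneg[OF B, of i] that
      by (simp add: Bi del: of_real_power)
    have "{i. B $ i $ i \<noteq> 0} \<subset> {i. A $ i $ i \<noteq> 0}"
      using Bz Bk k by blast
    then have "Q B"
      by (intro less.hyps B psubset_card_mono) auto
    then have "Q (B + outer v v)"
      by (rule add_outer)
    then show ?thesis by (simp add: B_def)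
  qed
qed

section \<open>Algebra and positivity of tensor products\<close>

lemma tensor_op_nth [simp]: "tensor_op M N $ r $ s = M $ fst r $ fst s * N $ snd r $ snd s"
  by (simp add: tensor_op_def)

lemma tensor_op_zero_left: "tensor_op 0 B = 0"
  by (simp add: vec_eq_iff)

lemma tensor_op_zero_right: "tensor_op A 0 = 0"
  by (simp add: vec_eq_iff)

lemma sum_UNIV_prod: "(\<Sum>r\<in>UNIV. f r) = (\<Sum>a\<in>UNIV. \<Sum>b\<in>UNIV. f (a, b))"
  by (simp add: sum.cartesian_product)

lemma tensor_op_mult: "tensor_op A B ** tensor_op C D = tensor_op (A ** C) (B ** D)"
  by (simp add: vec_eq_iff matrix_matrix_mult_def sum_UNIV_prod sum_product mult_ac)

lemma conj_transpose_tensor_op: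
  "conj_transpose (tensor_op A B) = tensor_op (conj_transpose A) (conj_transpose B)"
  by (simp add: vec_eq_iff)

lemma trace_tensor_op: "trace (tensor_op A B) = trace A * trace B"
  by (simp add: trace_def sum_UNIV_prod sum_product)

text \<open>By additivity in each factor, a nested induction reduces to rank-one factors. The tensor
  product of \<open>outer v v\<close> and \<open>outer w w\<close> is the outer product of the
  product vector \<open>u\<close> with itself.\<close>

lemma pos_semidef_tensor_op:
  assumes "pos_semidef A" "pos_semidef B"
  shows "pos_semidef (tensor_op A B)"
  using assms(1)
proof (induction A rule: pos_semidef_induct)
  case zero
  show ?case by (simp add: tensor_op_zero_left pos_semidef_zero)
next
  case (add_outer A v)
  from assms(2) have "pos_semidef (tensor_op (outer v v) B)"
  proof (induction B rule: pos_semidef_induct)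
    case zero
    show ?case by (simp add: tensor_op_zero_right pos_semidef_zero)
  next
    case (add_outer B w)
    define u where "u = (\<chi> r. v $ fst r * w $ snd r)"
    have "tensor_op (outer v v) (B + outer w w) = tensor_op (outer v v) B + outer u u"
      by (simp add: vec_eq_iff outer_def u_def algebra_simps)
    with add_outer show ?case by (simp add: pos_semidef_add pos_semidef_outer)
  qed
  moreover have "tensor_op (A + outer v v) B = tensor_op A B + tensor_op (outer v v) B"
    by (simp add: vec_eq_iff algebra_simps)
  ultimately show ?case
    using add_outer by (simp add: pos_semidef_add)
qed

section \<open>Regrouping of the factors and partial transposition\<close>

lemma regroup_nth [simp]:
  "regroup M $ r $ s = M $ (fst (fst r), (snd (fst r), snd r)) $ (fst (fst s), (snd (fst s), snd s))"
  by (simp add: regroup_def)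

lemma regroup_zero: "regroup 0 = 0"
  by (simp add: vec_eq_iff)

lemma regroup_mult: "regroup A ** regroup B = regroup (A ** B)"
  by (simp add: vec_eq_iff matrix_matrix_mult_def sum_UNIV_prod)

lemma conj_transpose_regroup: "conj_transpose (regroup A) = regroup (conj_transpose A)"
  by (simp add: vec_eq_iff)

lemma trace_regroup: "trace (regroup A) = trace A"
  by (simp add: trace_def sum_UNIV_prod)

text \<open>Regrouping relabels the basis, so its form at \<open>x\<close> is the form of
  \<open>A\<close> at the relabelled vector.\<close>

lemma pos_semidef_regroup:
  fixes A :: "('a::finite \<times> ('c::finite \<times> 'b::finite)) cop"
  assumes "pos_semidef A"
  shows "pos_semidef (regroup A)"
proof -
  have "cdot x (regroup A *v x) = cdot (\<chi> r. x $ ((fst r, fst (snd r)), snd (snd r)))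
          (A *v (\<chi> r. x $ ((fst r, fst (snd r)), snd (snd r))))" for x
    by (simp add: cdot_def matrix_vector_mult_def sum_UNIV_prod)
  then show ?thesis
    using assms by (simp add: pos_semidef_iff conj_transpose_regroup)
qed

lemma partial_transpose_nth [simp]:
  "partial_transpose M $ r $ s = M $ (fst r, snd s) $ (fst s, snd r)"
  by (simp add: partial_transpose_def)

text \<open>The index held by party B lies wholly within the second tensor factor, so transposing it
  leaves the first one untouched.\<close>

lemma partial_transpose_regroup_tensor_op:
  "partial_transpose (regroup (tensor_op A B)) = regroup (tensor_op A (partial_transpose B))"
  by (simp add: vec_eq_iff)

lemma partial_transpose_sum_scaleR:
  "partial_transpose (\<Sum>i\<in>I. r i *\<^sub>R A i) = (\<Sum>i\<in>I. r i *\<^sub>R partial_transpose (A i))"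
  by (simp add: vec_eq_iff)

section \<open>Trace norms of orthogonal sums\<close>

lemma trace_norm_eqI:
  "pos_semidef R \<Longrightarrow> R ** R = conj_transpose M ** M \<Longrightarrow> trace_norm M = Re (trace R)"
  by (simp add: trace_norm_def psd_sqrt_eqI)

text \<open>Only the diagonal of the double sum survives. It is applied both to the operators
  \<open>X i\<close> and to their absolute values \<open>R i\<close>.\<close>

lemma gram_orthogonal_sum:
  fixes X :: "'i \<Rightarrow> 'n::finite cop"
  assumes "finite I"
    and "\<And>i j. i \<in> I \<Longrightarrow> j \<in> I \<Longrightarrow> i \<noteq> j \<Longrightarrow> conj_transpose (X i) ** X j = 0"
  shows "conj_transpose (\<Sum>i\<in>I. p i *\<^sub>R X i) ** (\<Sum>i\<in>I. p i *\<^sub>R X i) =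
    (\<Sum>i\<in>I. (p i * p i) *\<^sub>R (conj_transpose (X i) ** X i))"
proof -
  have "conj_transpose (\<Sum>i\<in>I. p i *\<^sub>R X i) ** (\<Sum>i\<in>I. p i *\<^sub>R X i) =
      (\<Sum>i\<in>I. \<Sum>j\<in>I. (p i * p j) *\<^sub>R (conj_transpose (X i) ** X j))"
    unfolding conj_transpose_sum conj_transpose_scaleR matrix_mult_sum_left
    unfolding matrix_mult_sum_right matrix_mult_scaleR ..
  also have "\<dots> = (\<Sum>i\<in>I. \<Sum>j\<in>I. if j = i then (p i * p i) *\<^sub>R (conj_transpose (X i) ** X i) else 0)"
    using assms(2) by (intro sum.cong) auto
  finally show ?thesis
    using assms(1) by simp
qed

lemma trace_norm_orthogonal_sum:
  fixes X R :: "'i \<Rightarrow> 'n::finite cop"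
  assumes fin: "finite I" and p: "\<And>i. i \<in> I \<Longrightarrow> 0 \<le> p i"
    and R: "\<And>i. i \<in> I \<Longrightarrow> pos_semidef (R i)"
    and RX: "\<And>i. i \<in> I \<Longrightarrow> R i ** R i = conj_transpose (X i) ** X i"
    and X0: "\<And>i j. i \<in> I \<Longrightarrow> j \<in> I \<Longrightarrow> i \<noteq> j \<Longrightarrow> conj_transpose (X i) ** X j = 0"
    and R0: "\<And>i j. i \<in> I \<Longrightarrow> j \<in> I \<Longrightarrow> i \<noteq> j \<Longrightarrow> R i ** R j = 0"
  shows "trace_norm (\<Sum>i\<in>I. p i *\<^sub>R X i) = (\<Sum>i\<in>I. p i * Re (trace (R i)))"
proof -
  let ?S = "\<Sum>i\<in>I. p i *\<^sub>R R i"
  have herm: "conj_transpose (R i) = R i" if "i \<in> I" for i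
    using R[OF that] by (simp add: pos_semidef_iff)
  have S: "pos_semidef ?S"
    using p R by (intro pos_semidef_sum pos_semidef_scaleR)
  \<comment> \<open>Writing the square as a Gram matrix lets \<open>gram_orthogonal_sum\<close>
    treat both sides alike; the diagonal terms then agree by \<open>RX\<close>.\<close>
  then have "?S ** ?S = conj_transpose ?S ** ?S"
    by (simp add: pos_semidef_iff)
  also have "\<dots> = conj_transpose (\<Sum>i\<in>I. p i *\<^sub>R X i) ** (\<Sum>i\<in>I. p i *\<^sub>R X i)"
    using herm RX R0 X0 fin by (simp add: gram_orthogonal_sum)
  finally have "trace_norm (\<Sum>i\<in>I. p i *\<^sub>R X i) = Re (trace ?S)"
    by (rule trace_norm_eqI[OF S])
  then show ?thesis
    by (simp add: trace_sum_scaleR)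
qed

theorem mainTheorem2:
  fixes I :: "'i set" and p :: "'i \<Rightarrow> real"
    and \<phi> :: "'i \<Rightarrow> 'a::finite cop"
    and \<sigma> :: "'i \<Rightarrow> ('c::finite \<times> 'b::finite) cop"
    and \<rho> :: "(('a \<times> 'c) \<times> 'b) cop"
  assumes "finite I"
    and "\<And>i. i \<in> I \<Longrightarrow> p i \<ge> 0"
    and "(\<Sum>i\<in>I. p i) = 1"
    and "\<And>i. i \<in> I \<Longrightarrow> density_operator (\<phi> i)"
    and "\<And>i j. i \<in> I \<Longrightarrow> j \<in> I \<Longrightarrow> i \<noteq> j \<Longrightarrow> orthogonal_states (\<phi> i) (\<phi> j)"
    and "\<And>i. i \<in> I \<Longrightarrow> density_operator (\<sigma> i)"
    and "\<rho> = (\<Sum>i\<in>I. p i *\<^sub>R regroup (tensor_op (\<phi> i) (\<sigma> i)))"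
  shows "negativity \<rho> = (\<Sum>i\<in>I. p i * negativity (\<sigma> i))"
proof -
  define \<tau> where "\<tau> i = partial_transpose (\<sigma> i)" for i
  define S where "S i = psd_sqrt (conj_transpose (\<tau> i) ** \<tau> i)" for i
  define X where "X i = regroup (tensor_op (\<phi> i) (\<tau> i))" for i
  \<comment> \<open>This is the absolute value of \<open>X i\<close>: the state
    \<open>\<phi> i\<close>, being positive semidefinite, is its own absolute value.\<close>
  define R where "R i = regroup (tensor_op (\<phi> i) (S i))" for i
  have S: "pos_semidef (S i)" "S i ** S i = conj_transpose (\<tau> i) ** \<tau> i" for i
    unfolding S_def by (rule psd_sqrt_gram)+
  have \<phi>: "pos_semidef (\<phi> i)" "conj_transpose (\<phi> i) = \<phi> i" "trace (\<phi> i) = 1" if "i \<in> I" for i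
    using assms(4)[OF that] by (auto simp: density_operator_def pos_semidef_iff)
  have orth: "\<phi> i ** \<phi> j = 0" if "i \<in> I" "j \<in> I" "i \<noteq> j" for i j
    using assms(5)[OF that] by (simp add: orthogonal_states_def)
  have "partial_transpose \<rho> = (\<Sum>i\<in>I. p i *\<^sub>R X i)"
    by (simp add: assms(7) partial_transpose_sum_scaleR partial_transpose_regroup_tensor_op X_def \<tau>_def)
  also have "trace_norm \<dots> = (\<Sum>i\<in>I. p i * Re (trace (R i)))"
  proof (rule trace_norm_orthogonal_sum)
    show "pos_semidef (R i)" if "i \<in> I" for i
      unfolding R_def using \<phi>(1)[OF that] S(1) by (intro pos_semidef_regroup pos_semidef_tensor_op)
  \<comment> \<open>Products are taken factorwise, so \<open>\<phi> i ** \<phi> j = 0\<close>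
    annihilates every cross term whatever the second factor is.\<close>
  qed (use assms(1,2) \<phi> S orth in \<open>simp_all add: R_def X_def regroup_mult tensor_op_mult
      conj_transpose_regroup conj_transpose_tensor_op tensor_op_zero_left regroup_zero\<close>)
  \<comment> \<open>The trace is multiplicative on tensor products and each \<open>\<phi> i\<close>
    has trace one.\<close>
  also have "\<dots> = (\<Sum>i\<in>I. p i * trace_norm (\<tau> i))"
    using \<phi>(3) by (intro sum.cong)
      (auto simp: R_def trace_regroup trace_tensor_op trace_norm_def S_def)
  finally have *: "trace_norm (partial_transpose \<rho>) = (\<Sum>i\<in>I. p i * trace_norm (\<tau> i))" .
  have "(\<Sum>i\<in>I. p i * negativity (\<sigma> i)) = (\<Sum>i\<in>I. (p i * trace_norm (\<tau> i) - p i) / 2)"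
    by (intro sum.cong) (auto simp: negativity_def \<tau>_def algebra_simps)
  \<comment> \<open>The weights sum to one, so the offsets of the individual negativities add up to
    the single offset for \<open>\<rho>\<close>.\<close>
  also have "\<dots> = ((\<Sum>i\<in>I. p i * trace_norm (\<tau> i)) - 1) / 2"
    by (simp add: sum_divide_distrib[symmetric] sum_subtractf assms(3))
  finally show ?thesis
    by (simp add: negativity_def *)
qed

end
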